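(* Let $(\mathfrak g,\{-,\cdots,-\})$ be an $n$-pre-Lie algebra. Then the induced $n$-bracket $$[x_1,\cdots,x_n]_C=\sum_{i=1}^n(-1)^{n-i}\{x_1,\cdots,\widehat{x_i},\cdots,x_n,x_i\}$$ defines an $n$-Lie algebra structure on $\mathfrak g$.
   Context: All vector spaces are finite dimensional over an algebraically closed field of characteristic $0$; $n\ge2$; a hat denotes omission. An $n$-Lie algebra is a vector space $\mathfrak g$ with a skew-symmetric linear map $[-,\cdots,-]_{\mathfrak g}:\wedge^n\mathfrak g\to\mathfrak g$ such that $[x_1,\cdots,x_{n-1},[y_1,\cdots,y_n]]=\sum_{i=1}^n[y_1,\cdots,y_{i-1},[x_1,\cdots,x_{n-1},y_i],y_{i+1},\cdots,y_n]$. An $n$-pre-Lie algebra is a vector space $\mathfrak g$ with a multilinear map $\{-,\cdots,-\}:\wedge^{n-1}\mathfrak g\otimes\mathfrak g\to\mathfrak g$ such that for all $x_i,y_j\in\mathfrak g$: (1) $\{x_1,\cdots,x_{n-1},\{y_1,\cdots,y_{n-1},y_n\}\}=\sum_{i=1}^{n-1}\{y_1,\cdots,y_{i-1},[x_1,\cdots,x_{n-1},y_i]_C,y_{i+1},\cdots,y_n\}+\{y_1,\cdots,y_{n-1},\{x_1,\cdots,x_{n-1},y_n\}\}$; (2) $\{[y_1,\cdots,y_n]_C,x_1,\cdots,x_{n-2},x_{n-1}\}=\sum_{i=1}^n(-1)^{n-i}\{y_1,\cdots,\widehat{y_i},\cdots,y_n,\{y_i,x_1,\cdots,x_{n-2},x_{n-1}\}\}$,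 where $[x_1,\cdots,x_n]_C=\sum_{i=1}^n(-1)^{n-i}\{x_1,\cdots,\widehat{x_i},\cdots,x_n,x_i\}$. *)

theory Defs
  imports "HOL-Computational_Algebra.Polynomial"
begin

(* An m-tuple of vectors is a list of length m; nothing is said about the values of
   the operations on lists of any other length.  Entries are counted from 0. *)

(* Linear maps out of the m-th exterior power, represented as usual by the alternating
   multilinear maps of m arguments. *)
definition alternating_multilinear ::
    "('k::field \<Rightarrow> 'v::ab_group_add \<Rightarrow> 'v) \<Rightarrow> nat \<Rightarrow> ('v list \<Rightarrow> 'v) \<Rightarrow> bool" where
  "alternating_multilinear scale m f \<longleftrightarrow>
     (\<forall>xs i. length xs = m \<and> i < m \<longrightarrow> Vector_Spaces.linear scale scale (\<lambda>v. f (xs[i := v]))) \<and>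
     (\<forall>xs i j. length xs = m \<and> i < j \<and> j < m \<and> xs ! i = xs ! j \<longrightarrow> f xs = 0)"

definition omit :: "nat \<Rightarrow> 'a list \<Rightarrow> 'a list" where
  "omit i xs = take i xs @ drop (Suc i) xs"

locale n_Lie_algebra = finite_dimensional_vector_space scale Basis
  for scale :: "'k::{alg_closed_field, field_char_0} \<Rightarrow> 'v::ab_group_add \<Rightarrow> 'v" (infixr "*s" 75)
    and Basis :: "'v set" +
  fixes n :: nat
    and br :: "'v list \<Rightarrow> 'v"
  assumes n_ge_2: "n \<ge> 2"
    and br_alternating_multilinear: "alternating_multilinear scale n br"
    and fundamental_identity:
      "\<And>xs ys. length xs = n - 1 \<Longrightarrow> length ys = n \<Longrightarrow>
         br (xs @ [br ys]) = (\<Sum>i<n. br (ys[i := br (xs @ [ys ! i])]))"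

(* p xs y is the operation {x_1, ..., x_(n-1), y}, where xs lists x_1, ..., x_(n-1).
   The sign (-1)^(n-i) for i in 1..n becomes (-1)^(n - Suc i) for i < n. *)
definition induced_bracket ::
    "('k::field \<Rightarrow> 'v::ab_group_add \<Rightarrow> 'v) \<Rightarrow> nat \<Rightarrow> ('v list \<Rightarrow> 'v \<Rightarrow> 'v) \<Rightarrow> 'v list \<Rightarrow> 'v" where
  "induced_bracket scale n p xs = (\<Sum>i<n. scale ((-1) ^ (n - Suc i)) (p (omit i xs) (xs ! i)))"

locale n_pre_Lie_algebra = finite_dimensional_vector_space scale Basis
  for scale :: "'k::{alg_closed_field, field_char_0} \<Rightarrow> 'v::ab_group_add \<Rightarrow> 'v" (infixr "*s" 75)
    and Basis :: "'v set" +
  fixes n :: nat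
    and p :: "'v list \<Rightarrow> 'v \<Rightarrow> 'v"
  assumes n_ge_2: "n \<ge> 2"
    and p_alternating_multilinear: "\<And>y. alternating_multilinear scale (n - 1) (\<lambda>xs. p xs y)"
    and p_linear_last: "\<And>xs. length xs = n - 1 \<Longrightarrow> Vector_Spaces.linear scale scale (p xs)"
    and pre_Lie_1:
      "\<And>xs ys y. length xs = n - 1 \<Longrightarrow> length ys = n - 1 \<Longrightarrow>
         p xs (p ys y) =
           (\<Sum>i<n - 1. p (ys[i := induced_bracket scale n p (xs @ [ys ! i])]) y) + p ys (p xs y)"
    and pre_Lie_2:
      "\<And>xs ys x. length xs = n - 2 \<Longrightarrow> length ys = n \<Longrightarrow>
         p (induced_bracket scale n p ys # xs) x =
           (\<Sum>i<n. (-1) ^ (n - Suc i) *s p (omit i ys) (p (ys ! i # xs) x))"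

end

theory Submission
  imports Defs
begin

text \<open>
  Write \<open>C\<close> for the induced bracket and \<open>{x, y}\<close> for the given operation, and let \<open>x\<close>
  have \<open>n - 1\<close> entries and \<open>y\<close> have \<open>n\<close> entries.

  The bracket is multilinear term by term.  It is alternating because, if entries \<open>a < b\<close>
  coincide, every summand that omits neither of them vanishes, while the summands omitting
  \<open>a\<close> and \<open>b\<close> have argument lists that differ by a cycle of length \<open>b - a\<close>, so that they
  cancel (lemma \<open>alternating_move\<close>).

  For the fundamental identity, split \<open>C(x, C(y))\<close> into the summand \<open>{x, C(y)}\<close> and the summands
  with \<open>C(y)\<close> among the first \<open>n - 1\<close> arguments.  Expanding \<open>C(y)\<close> in \<open>{x, C(y)}\<close> and applying the
  first axiom yields all terms of the right-hand side in which \<open>C(x, y\<^sub>k)\<close> stands among the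
  first \<open>n - 1\<close> arguments, together with the terms \<open>\<plusminus>{\<dots>, {x, y\<^sub>k}}\<close>.  By the second axiom, moved to the
  last of the skew arguments (lemma \<open>pre_Lie_2_last\<close>), the remaining summands on the left are
  the terms \<open>\<plusminus>{\<dots>, {\<dots>, y\<^sub>k, x\<^sub>j}}\<close>.  Together these add up to \<open>\<plusminus>{\<dots>, C(x, y\<^sub>k)}\<close>, which is what is left of
  the right-hand side.
\<close>

section \<open>Omitting an entry of a list\<close>

lemma length_omit: "i < length xs \<Longrightarrow> length (omit i xs) = length xs - 1"
  by (simp add: omit_def)

text \<open>The position of the \<open>k\<close>-th entry of \<open>omit i xs\<close> within \<open>xs\<close>.\<close>
definition skip :: "nat \<Rightarrow> nat \<Rightarrow> nat" where
  "skip i k = (if k < i then k else Suc k)"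

lemma nth_omit:
  assumes "i < length xs" "k < length xs - 1"
  shows "omit i xs ! k = xs ! skip i k"
  using assms by (auto simp: omit_def skip_def nth_append min_def)

lemma omit_update_same: "omit i (xs[i := v]) = omit i xs"
  by (simp add: omit_def)

lemma omit_update_skip:
  assumes "i < length xs" "k < length xs - 1"
  shows "omit i (xs[skip i k := v]) = (omit i xs)[k := v]"
proof (rule nth_equalityI)
  fix l assume "l < length (omit i (xs[skip i k := v]))"
  then have "l < length xs - 1" using assms by (simp add: length_omit)
  then show "omit i (xs[skip i k := v]) ! l = (omit i xs)[k := v] ! l"
    using assms by (auto simp: nth_omit nth_list_update length_omit skip_def split: if_splits)
qed (use assms in \<open>simp add: length_omit\<close>)

lemma skip_surj:
  assumes "i < n" "k < n" "i \<noteq> k"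
  shows "\<exists>l < n - 1. k = skip i l"
proof (cases "k < i")
  case True
  then show ?thesis using assms by (intro exI[of _ k]) (simp add: skip_def)
next
  case False
  then show ?thesis using assms by (intro exI[of _ "k - 1"]) (auto simp: skip_def)
qed

lemma bij_betw_skip:
  assumes "i < Suc m"
  shows "bij_betw (skip i) {..<m} ({..<Suc m} - {i})"
proof (rule bij_betw_imageI)
  show "inj_on (skip i) {..<m}"
    by (auto simp: inj_on_def skip_def split: if_splits)
  show "skip i ` {..<m} = {..<Suc m} - {i}"
  proof (intro equalityI subsetI)
    fix k assume "k \<in> {..<Suc m} - {i}"
    then show "k \<in> skip i ` {..<m}"
      using skip_surj[OF assms, of k] by auto
  qed (use assms in \<open>auto simp: skip_def split: if_splits\<close>)
qed

lemma omit_middle: "omit (length us) (us @ v # ws) = us @ ws"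
  by (simp add: omit_def)

lemma omit_snoc_last: "omit (length xs) (xs @ [y]) = xs"
  by (simp add: omit_def)

lemma omit_snoc: "j < length xs \<Longrightarrow> omit j (xs @ [y]) = omit j xs @ [y]"
  by (simp add: omit_def)

section \<open>Alternating multilinear maps on lists\<close>

lemma alternating_add_slot:
  assumes "alternating_multilinear scale m f" "length us + length ws + 1 = m"
  shows "f (us @ (a + b) # ws) = f (us @ a # ws) + f (us @ b # ws)"
proof -
  have "Vector_Spaces.linear scale scale (\<lambda>v. f (xs[i := v]))" if "length xs = m" "i < m" for xs i
    using assms(1) that unfolding alternating_multilinear_def by blast
  from this[of "us @ a # ws" "length us"] assms(2)
  have "Vector_Spaces.linear scale scale (\<lambda>v. f (us @ v # ws))"
    by simp
  then show ?thesis
    by (auto simp: Vector_Spaces.linear_iff)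
qed

lemma alternating_swap:
  assumes f: "alternating_multilinear scale m f" and len: "length us + length ws + 2 = m"
  shows "f (us @ a # b # ws) = - f (us @ b # a # ws)"
proof -
  have zero: "f (us @ v # v # ws) = 0" for v
  proof -
    let ?xs = "us @ v # v # ws"
    have "length ?xs = m \<and> length us < Suc (length us) \<and> Suc (length us) < m
        \<and> ?xs ! length us = ?xs ! Suc (length us)"
      using len by (simp add: nth_append)
    then show ?thesis using f unfolding alternating_multilinear_def by blast
  qed
  have left: "f (us @ (a + b) # v # ws) = f (us @ a # v # ws) + f (us @ b # v # ws)" for v
    using alternating_add_slot[OF f, of us "v # ws"] len by simp
  have right: "f (us @ v # (a + b) # ws) = f (us @ v # a # ws) + f (us @ v # b # ws)" for v
    using alternating_add_slot[OF f, of "us @ [v]" ws] len by simp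
  have "0 = f (us @ (a + b) # (a + b) # ws)"
    by (simp add: zero)
  also have "\<dots> = f (us @ a # b # ws) + f (us @ b # a # ws)"
    unfolding left right by (simp add: zero)
  finally show ?thesis
    by (metis eq_neg_iff_add_eq_0)
qed

lemma alternating_move:
  assumes vs: "vector_space scale" and f: "alternating_multilinear scale m f"
    and len: "length us + length zs + length ws + 1 = m"
  shows "f (us @ zs @ v # ws) = scale ((-1) ^ length zs) (f (us @ v # zs @ ws))"
  using len
proof (induction zs arbitrary: us)
  case Nil
  then show ?case using vs by (simp add: vector_space.vector_space_assms)
next
  case (Cons z zs)
  interpret vector_space scale by fact
  have "f (us @ (z # zs) @ v # ws) = scale ((-1) ^ length zs) (f (us @ z # v # zs @ ws))"
    using Cons.IH[of "us @ [z]"] Cons.prems by simp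
  also have "f (us @ z # v # zs @ ws) = - f (us @ v # z # zs @ ws)"
    using alternating_swap[OF f, of us "zs @ ws" z v] Cons.prems by simp
  finally show ?case by simp
qed

section \<open>The induced bracket\<close>

context n_pre_Lie_algebra
begin

abbreviation C :: "'v list \<Rightarrow> 'v" where
  "C \<equiv> induced_bracket scale n p"

lemmas p_alternating = p_alternating_multilinear[unfolded alternating_multilinear_def]

lemma p_last_scale: "length xs = n - 1 \<Longrightarrow> p xs (c *s v) = c *s p xs v"
  and p_last_add: "length xs = n - 1 \<Longrightarrow> p xs (v + w) = p xs v + p xs w"
  using p_linear_last by (auto simp: Vector_Spaces.linear_iff)

lemma p_last_sum:
  assumes "length xs = n - 1"
  shows "p xs (\<Sum>i\<in>A. g i) = (\<Sum>i\<in>A. p xs (g i))"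
proof -
  interpret Vector_Spaces.linear scale scale "p xs" using p_linear_last[OF assms] .
  show ?thesis by (rule sum)
qed

lemma induced_bracket_linear:
  assumes "length xs = n" "k < n"
  shows "Vector_Spaces.linear scale scale (\<lambda>v. C (xs[k := v]))"
proof -
  have "Vector_Spaces.linear scale scale (\<lambda>v. p (omit i (xs[k := v])) (xs[k := v] ! i))"
    if i: "i < n" for i
  proof (cases "i = k")
    case True
    then show ?thesis
      using p_linear_last[of "omit k xs"] assms by (simp add: omit_update_same length_omit)
  next
    case False
    obtain l where l: "l < n - 1" "k = skip i l"
      using skip_surj[of i n k] assms(2) i False by auto
    have "Vector_Spaces.linear scale scale (\<lambda>v. p ((omit i xs)[l := v]) (xs ! i))"
      using p_alternating[of "xs ! i"] l assms i by (simp add: length_omit)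
    moreover have "omit i (xs[k := v]) = (omit i xs)[l := v]" for v
      using omit_update_skip[of i xs l v] l assms i by simp
    ultimately show ?thesis using False by simp
  qed
  then have "Vector_Spaces.linear scale scale (\<lambda>v. \<Sum>i<n. (-1) ^ (n - Suc i) *s
      p (omit i (xs[k := v])) (xs[k := v] ! i))"
    using vector_space_axioms
    by (auto simp: Vector_Spaces.linear_iff sum.distrib scale_right_distrib scale_sum_right
        mult.commute intro!: sum.cong)
  then show ?thesis by (simp add: induced_bracket_def)
qed

lemma induced_bracket_alternating:
  assumes len: "length xs = n" and ab: "a < b" "b < n" and eq: "xs ! a = xs ! b"
  shows "C xs = 0"
proof -
  let ?t = "\<lambda>i. (-1) ^ (n - Suc i) *s p (omit i xs) (xs ! i)"
  define v where "v = xs ! b"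
  have rest: "?t i = 0" if i: "i \<in> {..<n} - {a, b}" for i
  proof -
    obtain k where k: "k < n - 1" "a = skip i k"
      using skip_surj[of i n a] ab i by auto
    obtain l where l: "l < n - 1" "b = skip i l"
      using skip_surj[of i n b] ab i by auto
    have "k < l" using ab k l by (auto simp: skip_def split: if_splits)
    moreover have "omit i xs ! k = omit i xs ! l"
      using nth_omit[of i xs] i k l len eq by simp
    moreover have "length (omit i xs) = n - 1" using i len by (simp add: length_omit)
    ultimately have "p (omit i xs) (xs ! i) = 0"
      using p_alternating l by blast
    then show ?thesis by simp
  qed
  define us where "us = take a xs"
  define zs where "zs = take (b - Suc a) (drop (Suc a) xs)"
  define ws where "ws = drop (Suc b) xs"
  have zs: "length zs = b - Suc a" using ab len by (simp add: zs_def)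
  have xs: "xs = us @ v # zs @ v # ws"
  proof -
    have "drop (Suc a) xs = zs @ drop b xs"
      unfolding zs_def using ab by (metis Suc_leI append_take_drop_id drop_drop le_add_diff_inverse2)
    moreover have "drop b xs = v # ws" using ab len by (simp add: ws_def v_def Cons_nth_drop_Suc)
    ultimately show ?thesis
      using id_take_nth_drop[of a xs] ab len eq by (simp add: us_def v_def)
  qed
  have len_us: "length us = a" using ab len by (simp add: us_def)
  have len_sum: "length us + length zs + length ws + 1 = n - 1"
    using arg_cong[OF xs, of length] len by simp
  have omit_a: "omit a xs = us @ zs @ v # ws"
    by (subst xs) (use omit_middle[of us] len_us in simp)
  have omit_b: "omit b xs = us @ v # zs @ ws"
    by (subst xs) (use omit_middle[of "us @ v # zs" v ws] len_us zs ab in simp)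
  have "p (omit a xs) v = (-1) ^ length zs *s p (omit b xs) v"
    unfolding omit_a omit_b
    by (rule alternating_move[OF vector_space_axioms p_alternating_multilinear len_sum])
  then have "?t a = (-1) ^ (n - Suc a) *s (-1) ^ (b - Suc a) *s p (omit b xs) (xs ! b)"
    by (simp only: zs eq v_def)
  also have "\<dots> = - ?t b"
  proof -
    \<comment> \<open>The exponents \<open>n - 1 - a\<close> and \<open>n - 1 - b\<close> differ by \<open>b - a\<close>, one more than the length
       of the moved block.\<close>
    have exponent: "n - Suc a = Suc ((n - Suc b) + (b - Suc a))" using ab by simp
    have "(-1) ^ (n - Suc a) * (-1) ^ (b - Suc a) = (- ((-1) ^ (n - Suc b)) :: 'k)"
      unfolding exponent by (simp add: power_add mult.assoc flip: power_mult_distrib)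
    then show ?thesis by simp
  qed
  finally have pair: "?t a + ?t b = 0" by simp
  have "C xs = (\<Sum>i<n. ?t i)" by (simp add: induced_bracket_def)
  also have "\<dots> = (\<Sum>i\<in>{a, b}. ?t i)"
    using rest ab by (intro sum.mono_neutral_right) auto
  also have "\<dots> = 0" using pair ab by simp
  finally show ?thesis .
qed

lemma induced_bracket_alternating_multilinear: "alternating_multilinear scale n C"
  unfolding alternating_multilinear_def
  using induced_bracket_linear induced_bracket_alternating by blast

section \<open>The fundamental identity\<close>

lemma induced_bracket_snoc:
  assumes "length xs = n - 1"
  shows "C (xs @ [y]) =
    p xs y + (\<Sum>j<n - 1. (-1) ^ (n - Suc j) *s p (omit j xs @ [y]) (xs ! j))"
proof -
  obtain m where m: "n = Suc m" using n_ge_2 by (cases n) auto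
  show ?thesis
    using assms omit_snoc_last[of xs y]
    by (auto simp: induced_bracket_def m omit_snoc nth_append add.commute intro!: sum.cong)
qed

text \<open>The second axiom with the bracket in the last instead of the first of the \<open>n - 1\<close> skew
  arguments; the sign of the cyclic move occurs on both sides.\<close>
lemma pre_Lie_2_last:
  assumes zs: "length zs = n - 2" and ys: "length ys = n"
  shows "p (zs @ [C ys]) x = (\<Sum>i<n. (-1) ^ (n - Suc i) *s p (omit i ys) (p (zs @ [ys ! i]) x))"
proof -
  have move: "p (zs @ [v]) x = (-1) ^ (n - 2) *s p (v # zs) x" for v
    using alternating_move[OF vector_space_axioms p_alternating_multilinear, of "[]" zs "[]" v x]
      zs n_ge_2 by simp
  show ?thesis
    unfolding move pre_Lie_2[OF zs ys] scale_sum_right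
    by (intro sum.cong refl) (simp add: p_last_scale length_omit ys mult.commute)
qed

lemma induced_bracket_fundamental_identity:
  assumes xs: "length xs = n - 1" and ys: "length ys = n"
  shows "C (xs @ [C ys]) = (\<Sum>k<n. C (ys[k := C (xs @ [ys ! k])]))"
proof -
  obtain m where m: "n = Suc m" using n_ge_2 by (cases n) auto
  define s :: "nat \<Rightarrow> 'k" where "s i = (-1) ^ (n - Suc i)" for i
  define c where "c k = C (xs @ [ys ! k])" for k
  have len_omit: "length (omit i ys) = n - 1" if "i < n" for i
    using that ys by (simp add: length_omit)
  \<comment> \<open>\<open>D\<close> collects the terms with \<open>C(x, y\<^sub>k)\<close> among the skew arguments, \<open>E\<close> those of
     the form \<open>{\<dots>, {x, y\<^sub>k}}\<close>, and \<open>F\<close> those obtained from the second axiom.\<close>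
  define D where "D = (\<Sum>i<n. \<Sum>k\<in>{..<n} - {i}. s i *s p (omit i (ys[k := c k])) (ys ! i))"
  define E where "E = (\<Sum>i<n. s i *s p (omit i ys) (p xs (ys ! i)))"
  define F where "F = (\<Sum>i<n. \<Sum>j<n - 1.
    s i *s s j *s p (omit i ys) (p (omit j xs @ [ys ! i]) (xs ! j)))"

  have "p xs (C ys) = (\<Sum>i<n. s i *s p xs (p (omit i ys) (ys ! i)))"
    by (simp add: induced_bracket_def p_last_sum[OF xs] p_last_scale[OF xs] s_def)
  also have "\<dots> = (\<Sum>i<n. (\<Sum>k\<in>{..<n} - {i}. s i *s p (omit i (ys[k := c k])) (ys ! i)) +
      s i *s p (omit i ys) (p xs (ys ! i)))"
  proof (intro sum.cong refl)
    fix i assume "i \<in> {..<n}"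
    then have i: "i < n" by simp
    have "(\<Sum>k<n - 1. p ((omit i ys)[k := C (xs @ [omit i ys ! k])]) (ys ! i)) =
        (\<Sum>k<n - 1. p (omit i (ys[skip i k := c (skip i k)])) (ys ! i))"
      using i ys by (intro sum.cong refl) (simp add: omit_update_skip nth_omit c_def)
    also have "\<dots> = (\<Sum>k\<in>{..<n} - {i}. p (omit i (ys[k := c k])) (ys ! i))"
      using sum.reindex_bij_betw[OF bij_betw_skip[of i m],
          of "\<lambda>k. p (omit i (ys[k := c k])) (ys ! i)"] i m by simp
    finally show "s i *s p xs (p (omit i ys) (ys ! i)) =
        (\<Sum>k\<in>{..<n} - {i}. s i *s p (omit i (ys[k := c k])) (ys ! i)) +
        s i *s p (omit i ys) (p xs (ys ! i))"
      by (simp add: pre_Lie_1[OF xs len_omit[OF i]] scale_right_distrib scale_sum_right)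
  qed
  finally have head: "p xs (C ys) = D + E"
    by (simp add: D_def E_def sum.distrib)

  have "(\<Sum>j<n - 1. s j *s p (omit j xs @ [C ys]) (xs ! j)) =
      (\<Sum>j<n - 1. \<Sum>i<n. s i *s s j *s p (omit i ys) (p (omit j xs @ [ys ! i]) (xs ! j)))"
    using xs ys
    by (intro sum.cong refl)
      (simp add: pre_Lie_2_last length_omit scale_sum_right s_def mult.commute)
  also have "\<dots> = F"
    unfolding F_def by (rule sum.swap)
  finally have left: "C (xs @ [C ys]) = D + E + F"
    by (simp add: induced_bracket_snoc[OF xs] head flip: s_def)

  have "(\<Sum>k<n. C (ys[k := c k])) =
      (\<Sum>k<n. \<Sum>i<n. s i *s p (omit i (ys[k := c k])) (ys[k := c k] ! i))"
    by (simp add: induced_bracket_def s_def)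
  also have "\<dots> = (\<Sum>i<n. \<Sum>k<n. s i *s p (omit i (ys[k := c k])) (ys[k := c k] ! i))"
    by (rule sum.swap)
  also have "\<dots> = (\<Sum>i<n. s i *s p (omit i ys) (c i) +
      (\<Sum>k\<in>{..<n} - {i}. s i *s p (omit i (ys[k := c k])) (ys ! i)))"
  proof (intro sum.cong refl)
    fix i assume "i \<in> {..<n}"
    then show "(\<Sum>k<n. s i *s p (omit i (ys[k := c k])) (ys[k := c k] ! i)) =
        s i *s p (omit i ys) (c i) +
        (\<Sum>k\<in>{..<n} - {i}. s i *s p (omit i (ys[k := c k])) (ys ! i))"
      using ys by (subst sum.remove[of _ i]) (auto simp: omit_update_same intro!: sum.cong)
  qed
  also have "\<dots> = (\<Sum>i<n. s i *s p (omit i ys) (c i)) + D"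
    by (simp add: D_def sum.distrib)
  also have "(\<Sum>i<n. s i *s p (omit i ys) (c i)) = E + F"
    unfolding E_def F_def sum.distrib[symmetric]
  proof (intro sum.cong refl)
    fix i assume "i \<in> {..<n}"
    then have "length (omit i ys) = n - 1" by (simp add: len_omit)
    then show "s i *s p (omit i ys) (c i) = s i *s p (omit i ys) (p xs (ys ! i)) +
        (\<Sum>j<n - 1. s i *s s j *s p (omit i ys) (p (omit j xs @ [ys ! i]) (xs ! j)))"
      by (simp add: c_def induced_bracket_snoc[OF xs] p_last_add p_last_sum p_last_scale
          scale_right_distrib scale_sum_right s_def)
  qed
  finally show ?thesis
    using left by (simp add: c_def ac_simps)
qed

end

theorem proposition3p14:
  fixes scale :: "'k::{alg_closed_field, field_char_0} \<Rightarrow> 'v::ab_group_add \<Rightarrow> 'v"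
    and Basis :: "'v set"
    and n :: nat
    and p :: "'v list \<Rightarrow> 'v \<Rightarrow> 'v"
  assumes "n_pre_Lie_algebra scale Basis n p"
  shows "n_Lie_algebra scale Basis n (induced_bracket scale n p)"
proof -
  interpret n_pre_Lie_algebra scale Basis n p by fact
  show ?thesis
    by unfold_locales
      (use n_ge_2 induced_bracket_alternating_multilinear
        induced_bracket_fundamental_identity in auto)
qed

end
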